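(* Let $k \ge 1$ and $h \ge 2$ be positive integers and let $G = (U,V,E)$ be a bipartite graph. Suppose that for all $S \subseteq U$, $$|\Gamma(S)| \ge \left(h-1+\frac{1}{\lceil k/h \rceil}\right)|S|.$$ Then $G$ has an $(h,hk)$-matching.
   Context: All graphs are finite and simple. $G=(U,V,E)$ denotes a bipartite graph with left vertex class $U$, right vertex class $V$ and edge set $E$. For a set $S$ of vertices, $\Gamma(S)$ denotes the set of vertices adjacent to at least one vertex of $S$. For positive integers $t \ge s$, an $(s,t)$-matching in $G=(U,V,E)$ is a subset $F \subseteq E$ such that, in the graph $H=(U,V,F)$, each connected component is a tree with at most $t$ edges, and every $u \in U$ has degree $d_H(u)=s$. *)

theory Defs
  imports Complex_Main
begin

text \<open>
  A graph is given by its vertex set \<open>W\<close> and its edge set \<open>E\<close>, edges being two-element vertex sets.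
\<close>

definition simple_graph :: "'a set \<Rightarrow> 'a set set \<Rightarrow> bool" where
  "simple_graph W E \<longleftrightarrow> finite W \<and> (\<forall>e\<in>E. e \<subseteq> W \<and> card e = 2)"

definition bipartite_graph :: "'a set \<Rightarrow> 'a set \<Rightarrow> 'a set set \<Rightarrow> bool" where
  "bipartite_graph U V E \<longleftrightarrow>
     simple_graph (U \<union> V) E \<and> U \<inter> V = {} \<and> (\<forall>e\<in>E. \<exists>u\<in>U. \<exists>v\<in>V. e = {u, v})"

definition neighbours :: "'a set set \<Rightarrow> 'a set \<Rightarrow> 'a set" where
  "neighbours E S = {w. \<exists>x\<in>S. {x, w} \<in> E}"

definition degree :: "'a set set \<Rightarrow> 'a \<Rightarrow> nat" where
  "degree E x = card {e \<in> E. x \<in> e}"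

definition walk :: "'a set \<Rightarrow> 'a set set \<Rightarrow> 'a list \<Rightarrow> bool" where
  "walk W E p \<longleftrightarrow> p \<noteq> [] \<and> set p \<subseteq> W \<and> successively (\<lambda>x y. {x, y} \<in> E) p"

definition connected_graph :: "'a set \<Rightarrow> 'a set set \<Rightarrow> bool" where
  "connected_graph W E \<longleftrightarrow>
     W \<noteq> {} \<and> (\<forall>x\<in>W. \<forall>y\<in>W. \<exists>p. walk W E p \<and> hd p = x \<and> last p = y)"

text \<open>A cycle is listed without repeating its first vertex at the end.\<close>

definition cycle :: "'a set \<Rightarrow> 'a set set \<Rightarrow> 'a list \<Rightarrow> bool" where
  "cycle W E p \<longleftrightarrow> walk W E p \<and> distinct p \<and> 3 \<le> length p \<and> {last p, hd p} \<in> E"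

definition tree :: "'a set \<Rightarrow> 'a set set \<Rightarrow> bool" where
  "tree W E \<longleftrightarrow> connected_graph W E \<and> (\<nexists>p. cycle W E p)"

definition induced_edges :: "'a set set \<Rightarrow> 'a set \<Rightarrow> 'a set set" where
  "induced_edges E C = {e \<in> E. e \<subseteq> C}"

text \<open>
  A connected component is represented by its vertex set \<open>C\<close>; as a graph it is
  \<open>C\<close> together with \<open>induced_edges E C\<close>. An isolated vertex is a component without edges.
\<close>

definition component :: "'a set \<Rightarrow> 'a set set \<Rightarrow> 'a set \<Rightarrow> bool" where
  "component W E C \<longleftrightarrow>
     C \<subseteq> W \<and> connected_graph C (induced_edges E C) \<and>
     (\<forall>D. C \<subset> D \<and> D \<subseteq> W \<longrightarrow> \<not> connected_graph D (induced_edges E D))"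

text \<open>Intended for \<open>1 \<le> s \<le> t\<close>.\<close>

definition st_matching ::
  "nat \<Rightarrow> nat \<Rightarrow> 'a set \<Rightarrow> 'a set \<Rightarrow> 'a set set \<Rightarrow> 'a set set \<Rightarrow> bool" where
  "st_matching s t U V E F \<longleftrightarrow>
     F \<subseteq> E \<and>
     (\<forall>C. component (U \<union> V) F C \<longrightarrow>
        tree C (induced_edges F C) \<and> card (induced_edges F C) \<le> t) \<and>
     (\<forall>u\<in>U. degree F u = s)"

end

theory Submission
  imports Defs
begin

text \<open>
  Put \<open>q = \<lceil>k / h\<rceil>\<close>. The hypothesis is a fractional Hall condition: there are weights \<open>x u v \<ge> 0\<close> on the
  edges, with support a forest, such that every \<open>u \<in> U\<close> sends at least \<open>q (h - 1) + 1\<close> and every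
  \<open>v \<in> V\<close> receives at most \<open>q\<close>. The support is consumed from its leaves. Let \<open>s v\<close> be the number of
  processed left vertices already hanging at \<open>v\<close>; the invariant is that \<open>s v\<close> plus the weight
  still arriving at \<open>v\<close> is at most \<open>q\<close>. Take a left vertex \<open>u\<close> all of whose remaining neighbours except
  possibly one, \<open>p\<close>, are leaves. If \<open>u\<close> has \<open>h\<close> neighbours other than \<open>p\<close>, join \<open>u\<close> to them and cut it off from
  \<open>p\<close>. Otherwise \<open>u\<close> has exactly \<open>h\<close> neighbours and keeps all of them; since the leaves \<open>v\<close> absorb at
  most \<open>q - s v\<close> each, \<open>x u p\<close> is at least the number of left vertices that \<open>u\<close> brings
  along, so the invariant at \<open>p\<close> survives. In either case the neighbours used have \<open>s v \<le> q - 1\<close>, so the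
  new component has at most \<open>1 + h (q - 1) \<le> k\<close> left vertices.
\<close>

section \<open>Forests as sets of pairs\<close>

text \<open>
  The support of the weights is a set of pairs; it is a forest iff every nonempty finite subset has
  fewer edges than endpoints. In this form the property is additive over a bridge.
\<close>

definition acyclic_pairs :: "('a \<times> 'b) set \<Rightarrow> bool" where
  "acyclic_pairs P \<longleftrightarrow>
     (\<forall>A\<subseteq>P. finite A \<longrightarrow> A \<noteq> {} \<longrightarrow> card A < card (fst ` A) + card (snd ` A))"

lemma acyclic_pairsD:
  "acyclic_pairs P \<Longrightarrow> A \<subseteq> P \<Longrightarrow> finite A \<Longrightarrow> A \<noteq> {} \<Longrightarrow>
    card A < card (fst ` A) + card (snd ` A)"
  unfolding acyclic_pairs_def by blast

lemma acyclic_pairs_mono: "acyclic_pairs P \<Longrightarrow> Q \<subseteq> P \<Longrightarrow> acyclic_pairs Q"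
  unfolding acyclic_pairs_def by blast

lemma acyclic_pairs_empty: "acyclic_pairs {}"
  unfolding acyclic_pairs_def by blast

text \<open>Each of \<open>A \<inter> P\<close> and \<open>A \<inter> Q\<close>, if nonempty, has at
  least one endpoint more than edges, so two nonempty sides leave room for the bridge; if one side
  is empty, the bridge brings a new endpoint to the other.\<close>

lemma acyclic_pairs_bridge:
  assumes P: "acyclic_pairs P" and Q: "acyclic_pairs Q"
    and fd: "fst ` P \<inter> fst ` Q = {}" and sd: "snd ` P \<inter> snd ` Q = {}"
    and u: "u \<notin> fst ` P" and v: "v \<notin> snd ` Q"
  shows "acyclic_pairs (insert (u, v) (P \<union> Q))"
  unfolding acyclic_pairs_def
proof (intro allI impI)
  fix A assume A: "A \<subseteq> insert (u, v) (P \<union> Q)" "finite A" "A \<noteq> {}"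
  define B where "B = A \<inter> P"
  define C where "C = A \<inter> Q"
  have fin: "finite B" "finite C" using A by (auto simp: B_def C_def)
  have B: "B = {} \<or> card B < card (fst ` B) + card (snd ` B)"
    using acyclic_pairsD[OF P _ fin(1)] by (auto simp: B_def)
  have C: "C = {} \<or> card C < card (fst ` C) + card (snd ` C)"
    using acyclic_pairsD[OF Q _ fin(2)] by (auto simp: C_def)
  have f: "card (fst ` (B \<union> C)) = card (fst ` B) + card (fst ` C)"
    unfolding image_Un using fin fd by (intro card_Un_disjoint) (auto simp: B_def C_def)
  have s: "card (snd ` (B \<union> C)) = card (snd ` B) + card (snd ` C)"
    unfolding image_Un using fin sd by (intro card_Un_disjoint) (auto simp: B_def C_def)
  have BC: "card (B \<union> C) \<le> card B + card C" by (rule card_Un_le)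
  show "card A < card (fst ` A) + card (snd ` A)"
  proof (cases "(u, v) \<in> A")
    case False
    then have AA: "A = B \<union> C" using A by (auto simp: B_def C_def)
    show ?thesis using A(3) AA B C BC f s by auto
  next
    case True
    then have AA: "A = insert (u, v) (B \<union> C)" using A by (auto simp: B_def C_def)
    have cA: "card A \<le> Suc (card B + card C)"
      unfolding AA using BC fin by (simp add: card_insert_if)
    have fB: "card (fst ` (B \<union> C)) \<le> card (fst ` A)" "card (snd ` (B \<union> C)) \<le> card (snd ` A)"
      using A(2) AA by (auto intro!: card_mono)
    have uB: "card (fst ` A) > card (fst ` B)"
    proof -
      have "card (insert u (fst ` B)) \<le> card (fst ` A)"
        using A(2) AA by (intro card_mono) auto
      moreover have "u \<notin> fst ` B" using u by (auto simp: B_def)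
      ultimately show ?thesis using fin by simp
    qed
    have vC: "card (snd ` A) > card (snd ` C)"
    proof -
      have "card (insert v (snd ` C)) \<le> card (snd ` A)"
        using A(2) AA by (intro card_mono) auto
      moreover have "v \<notin> snd ` C" using v by (auto simp: C_def)
      ultimately show ?thesis using fin by simp
    qed
    show ?thesis
    proof -
      consider "B = {}" "C = {}" | "B = {}" "C \<noteq> {}" | "B \<noteq> {}" "C = {}" | "B \<noteq> {}" "C \<noteq> {}"
        by blast
      then show ?thesis
      proof cases
        case 1
        then show ?thesis using cA uB vC by simp
      next
        case 2
        then have "card C < card (fst ` C) + card (snd ` C)" "card B = 0"
          using C by simp_all
        then show ?thesis using cA fB f vC by linarith
      next
        case 3
        then have "card B < card (fst ` B) + card (snd ` B)" "card C = 0"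
          using B by simp_all
        then show ?thesis using cA fB s uB by linarith
      next
        case 4
        then have "card B < card (fst ` B) + card (snd ` B)" "card C < card (fst ` C) + card (snd ` C)"
        using B C by simp_all
      then show ?thesis using cA fB f s by linarith
      qed
    qed
  qed
qed

text \<open>To be applied to the two projections of an edge set: a side on which all degrees are at
  least two has at most half as many vertices as there are edges.\<close>

lemma twice_card_image_le:
  assumes "finite A" and "\<And>x. x \<in> A \<Longrightarrow> \<exists>y\<in>A. y \<noteq> x \<and> g y = g x"
  shows "2 * card (g ` A) \<le> card A"
proof -
  have "2 \<le> card {x \<in> A. g x = z}" if z: "z \<in> g ` A" for z
  proof -
    obtain x y where xy: "x \<in> A" "y \<in> A" "y \<noteq> x" "g x = z" "g y = z"
      using z assms(2) by blast
    have "card {x, y} \<le> card {x \<in> A. g x = z}"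
      using xy assms(1) by (intro card_mono) auto
    then show ?thesis using xy by simp
  qed
  then have "(\<Sum>z\<in>g ` A. 2) \<le> (\<Sum>z\<in>g ` A. card {x \<in> A. g x = z})"
    by (intro sum_mono)
  also have "\<dots> = card A"
    using sum.image_gen[OF assms(1), of "\<lambda>_. 1::nat" g] by simp
  finally show ?thesis by simp
qed

text \<open>Otherwise the edges at \<open>X\<close> that remain after deleting right vertices with
  only one neighbour in \<open>X\<close> give each of their endpoints degree at least two, and there
  are at least as many edges as endpoints.\<close>

lemma acyclic_pairs_near_leaf:
  assumes ac: "acyclic_pairs P" and fin: "finite P" and ne: "X \<noteq> {}"
  shows "\<exists>u\<in>X. \<exists>p. \<forall>v w. (u, v) \<in> P \<longrightarrow> v \<noteq> p \<longrightarrow> w \<in> X \<longrightarrow> (w, v) \<in> P \<longrightarrow> w = u"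
proof (rule ccontr)
  assume no: "\<not> ?thesis"
  define A where "A = {(u, v). u \<in> X \<and> (u, v) \<in> P \<and> (\<exists>w\<in>X. w \<noteq> u \<and> (w, v) \<in> P)}"
  have AP: "A \<subseteq> P" by (auto simp: A_def)
  have finA: "finite A" using AP fin finite_subset by blast
  \<comment> \<open>Failure at \<open>u\<close> holds for every exceptional \<open>p\<close>: taking
    the right end of one edge of \<open>A\<close> at \<open>u\<close> as \<open>p\<close> yields a
    second edge.\<close>
  have other: "\<exists>v. v \<noteq> p \<and> (u, v) \<in> A" if "u \<in> X" for u p
    using no that unfolding A_def by blast
  have ne': "A \<noteq> {}" using other ne by blast
  have "2 * card (fst ` A) \<le> card A"
    using finA
  proof (rule twice_card_image_le)
    fix e assume "e \<in> A"
    then obtain u v where e: "e = (u, v)" "u \<in> X"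
      by (auto simp: A_def)
    obtain v' where "v' \<noteq> v" "(u, v') \<in> A" using other[OF e(2)] by blast
    then show "\<exists>y\<in>A. y \<noteq> e \<and> fst y = fst e"
      using e(1) by (intro bexI[of _ "(u, v')"]) auto
  qed
  moreover have "2 * card (snd ` A) \<le> card A"
    using finA
  proof (rule twice_card_image_le)
    fix e assume "e \<in> A"
    then obtain u v w where "e = (u, v)" "w \<in> X" "w \<noteq> u" "(w, v) \<in> P" "u \<in> X" "(u, v) \<in> P"
      by (auto simp: A_def)
    then show "\<exists>y\<in>A. y \<noteq> e \<and> snd y = snd e"
      by (intro bexI[of _ "(w, v)"]) (auto simp: A_def)
  qed
  moreover have "card A < card (fst ` A) + card (snd ` A)"
    using acyclic_pairsD[OF ac AP finA ne'] .
  ultimately show False by linarith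
qed

section \<open>Fractional matchings with forest support\<close>

text \<open>The weight is a total function vanishing off the edges between \<open>U\<close> and
  \<open>V\<close>, so sums over part of a vertex class extend to the whole class and weights on
  disjoint parts can be added pointwise.\<close>

definition fractional_matching ::
  "('a \<times> 'b) set \<Rightarrow> 'a set \<Rightarrow> 'b set \<Rightarrow> ('a \<Rightarrow> real) \<Rightarrow> ('b \<Rightarrow> real) \<Rightarrow> ('a \<Rightarrow> 'b \<Rightarrow> real) \<Rightarrow> bool" where
  "fractional_matching R U V d c x \<longleftrightarrow>
     (\<forall>u v. 0 \<le> x u v) \<and> (\<forall>u v. x u v \<noteq> 0 \<longrightarrow> u \<in> U \<and> v \<in> V \<and> (u, v) \<in> R) \<and>
     (\<forall>u\<in>U. d u \<le> (\<Sum>v\<in>V. x u v)) \<and> (\<forall>v\<in>V. (\<Sum>u\<in>U. x u v) \<le> c v) \<and>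
     acyclic_pairs {(u, v). x u v \<noteq> 0}"

text \<open>
  Induction on the number of vertices: for an edge \<open>(u, v)\<close>, choose \<open>S\<close> avoiding \<open>u\<close> and \<open>T\<close> containing
  \<open>v\<close> and the neighbours of \<open>S\<close> with the least slack \<open>m = c T - d S\<close>, and send \<open>m\<close> along the edge. Then
  \<open>(S, T)\<close> and its complement satisfy the condition separately, with \<open>(u, v)\<close> as the only bridge. The
  demand \<open>d u\<close> may become negative, which is harmless.
\<close>

lemma fractional_hall:
  fixes c :: "'b \<Rightarrow> real" and d :: "'a \<Rightarrow> real"
  assumes "finite U" "finite V"
    and "\<And>v. v \<in> V \<Longrightarrow> 0 \<le> c v"
    and "\<And>S. S \<subseteq> U \<Longrightarrow> sum d S \<le> sum c (R `` S \<inter> V)"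
  shows "\<exists>x. fractional_matching R U V d c x"
  using assms
proof (induction "card U + card V" arbitrary: U V c d rule: less_induct)
  case less
  note fU = less.prems(1) and fV = less.prems(2) and c0 = less.prems(3) and hall = less.prems(4)
  show ?case
  proof (cases "R \<inter> U \<times> V = {}")
    case True
    have "d u \<le> 0" if "u \<in> U" for u
    proof -
      have "R `` {u} \<inter> V = {}" using True that by blast
      then show ?thesis using hall[of "{u}"] that by simp
    qed
    then show ?thesis
      using c0 by (intro exI[of _ "\<lambda>_ _. 0"]) (auto simp: fractional_matching_def acyclic_pairs_empty)
  next
    case False
    then obtain u v where uv: "(u, v) \<in> R" "u \<in> U" "v \<in> V" by blast
    define Z where "Z = {(S, T). S \<subseteq> U - {u} \<and> T \<subseteq> V \<and> R `` S \<inter> V \<subseteq> T \<and> v \<in> T}"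
    define sl where "sl = (\<lambda>(S, T). sum c T - sum d S)"
    have "Z \<subseteq> Pow U \<times> Pow V" by (auto simp: Z_def)
    then have finZ: "finite Z" using fU fV finite_subset by blast
    have Zv: "({}, {v}) \<in> Z" using uv by (auto simp: Z_def)
    define m where "m = Min (sl ` Z)"
    have "m \<in> sl ` Z" unfolding m_def using finZ Zv by (intro Min_in) auto
    then obtain S T where ST: "(S, T) \<in> Z" and m: "m = sum c T - sum d S"
      by (auto simp: sl_def)
    have min: "m \<le> sum c T' - sum d S'" if "(S', T') \<in> Z" for S' T'
    proof -
      have "m \<le> sl (S', T')" unfolding m_def using finZ that by (intro Min_le) auto
      then show ?thesis by (simp add: sl_def)
    qed
    have SU: "S \<subseteq> U" "u \<notin> S" "T \<subseteq> V" "v \<in> T" "R `` S \<inter> V \<subseteq> T"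
      using ST by (auto simp: Z_def)
    have fT: "finite T" "finite S" using SU fU fV finite_subset by blast+
    \<comment> \<open>The pair \<open>({}, {v})\<close> has slack \<open>c v\<close>, so the
      capacity left at \<open>v\<close> after sending \<open>m\<close> is nonnegative.\<close>
    have mc: "m \<le> c v" using min[OF Zv] by simp
    have "sum d S \<le> sum c (R `` S \<inter> V)" using hall SU by blast
    also have "\<dots> \<le> sum c T" using SU c0 fT by (intro sum_mono2) auto
    finally have m0: "0 \<le> m" using m by simp
    define c1 where "c1 = c(v := c v - m)"
    define d2 where "d2 = d(u := d u - m)"
    have "card S + card T < card U + card V"
      using SU uv fU fV by (metis add_less_le_mono card_mono psubset_card_mono psubsetI)
    moreover have "0 \<le> c1 w" if "w \<in> T" for w
      using that c0 SU mc by (auto simp: c1_def)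
    moreover have "sum d S' \<le> sum c1 (R `` S' \<inter> T)" if S': "S' \<subseteq> S" for S'
    proof -
      have eq: "R `` S' \<inter> T = R `` S' \<inter> V" using S' SU by blast
      have fin: "finite (R `` S' \<inter> V)" using fV by auto
      \<comment> \<open>The lowered capacity matters only if \<open>v\<close> is a neighbour of
        \<open>S'\<close>; then \<open>S'\<close> and its neighbourhood compete in the minimum and
        have slack at least \<open>m\<close>.\<close>
      show ?thesis
      proof (cases "v \<in> R `` S'")
        case True
        then have "(S', R `` S' \<inter> V) \<in> Z" using S' SU uv by (auto simp: Z_def)
        from min[OF this] have "sum d S' \<le> sum c (R `` S' \<inter> V) - m" by simp
        also have "sum c (R `` S' \<inter> V) - m = sum c1 (R `` S' \<inter> V)"
          using True uv(3) sum.remove[OF fin, of v c] sum.remove[OF fin, of v c1]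
          by (simp add: c1_def)
        finally show ?thesis using eq by simp
      next
        case False
        then have "sum c1 (R `` S' \<inter> V) = sum c (R `` S' \<inter> V)"
          by (intro sum.cong) (auto simp: c1_def)
        then show ?thesis using hall[of S'] S' SU eq by auto
      qed
    qed
    ultimately have "\<exists>x. fractional_matching R S T d c1 x"
      using fT by (intro less.hyps)
    then obtain x where fx: "fractional_matching R S T d c1 x" by blast
    have x: "\<And>a b. 0 \<le> x a b"
      "\<And>a b. x a b \<noteq> 0 \<Longrightarrow> a \<in> S \<and> b \<in> T \<and> (a, b) \<in> R"
      "\<And>a. a \<in> S \<Longrightarrow> d a \<le> (\<Sum>b\<in>T. x a b)"
      "\<And>b. b \<in> T \<Longrightarrow> (\<Sum>a\<in>S. x a b) \<le> c1 b"
      "acyclic_pairs {(a, b). x a b \<noteq> 0}"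
      using fx unfolding fractional_matching_def by blast+
    have "card (U - S) \<le> card U" "card (V - T) < card V"
      using SU uv fU fV by (auto intro: card_mono psubset_card_mono)
    then have "card (U - S) + card (V - T) < card U + card V" by simp
    moreover have "sum d2 A \<le> sum c (R `` A \<inter> (V - T))" if A: "A \<subseteq> U - S" for A
    proof -
      have fin: "finite A" using A fU by (meson finite_Diff finite_subset)
      have split: "sum c (T \<union> R `` A \<inter> (V - T)) = sum c T + sum c (R `` A \<inter> (V - T))"
        using fT fV by (intro sum.union_disjoint) auto
      have dsplit: "sum d (S \<union> A) = sum d S + sum d A"
        using fT fin A by (intro sum.union_disjoint) auto
      \<comment> \<open>If \<open>u\<close> is in \<open>A\<close>, its demand has dropped by
        exactly the slack \<open>m\<close> of \<open>(S, T)\<close>, so the condition for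
        \<open>S \<union> A\<close> suffices. Otherwise \<open>S \<union> A\<close>, with
        \<open>T\<close> enlarged by the neighbours of \<open>A\<close>, competes in the
        minimum.\<close>
      show ?thesis
      proof (cases "u \<in> A")
        case True
        have "sum d (S \<union> A) \<le> sum c (R `` (S \<union> A) \<inter> V)" using hall A SU by blast
        also have "\<dots> \<le> sum c (T \<union> R `` A \<inter> (V - T))"
          using SU c0 fT fV by (intro sum_mono2) auto
        finally have "sum d A - m \<le> sum c (R `` A \<inter> (V - T))"
          using split dsplit m by simp
        moreover have "sum d2 A = sum d A - m"
          using True sum.remove[OF fin, of u d] sum.remove[OF fin, of u d2]
          by (simp add: d2_def)
        ultimately show ?thesis by simp
      next
        case False
        then have "(S \<union> A, T \<union> R `` A \<inter> (V - T)) \<in> Z" using A SU by (auto simp: Z_def)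
        from min[OF this] have "sum d A \<le> sum c (R `` A \<inter> (V - T))"
          using split dsplit m by simp
        moreover have "sum d2 A = sum d A"
          using False by (intro sum.cong) (auto simp: d2_def)
        ultimately show ?thesis by simp
      qed
    qed
    ultimately have "\<exists>x. fractional_matching R (U - S) (V - T) d2 c x"
      using fU fV c0 by (intro less.hyps) auto
    then obtain y where fy: "fractional_matching R (U - S) (V - T) d2 c y" by blast
    have y: "\<And>a b. 0 \<le> y a b"
      "\<And>a b. y a b \<noteq> 0 \<Longrightarrow> a \<in> U - S \<and> b \<in> V - T \<and> (a, b) \<in> R"
      "\<And>a. a \<in> U - S \<Longrightarrow> d2 a \<le> (\<Sum>b\<in>V - T. y a b)"
      "\<And>b. b \<in> V - T \<Longrightarrow> (\<Sum>a\<in>U - S. y a b) \<le> c b"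
      "acyclic_pairs {(a, b). y a b \<noteq> 0}"
      using fy unfolding fractional_matching_def by blast+
    define \<delta> where "\<delta> = (\<lambda>a b. if a = u \<and> b = v then m else 0)"
    define z where "z = (\<lambda>a b. x a b + y a b + \<delta> a b)"
    have \<delta>0: "0 \<le> \<delta> a b" for a b using m0 by (simp add: \<delta>_def)
    have z0: "0 \<le> z a b" for a b using x(1)[of a b] y(1)[of a b] \<delta>0[of a b] by (simp add: z_def)
    have rowx: "(\<Sum>b\<in>T. x a b) = (\<Sum>b\<in>V. x a b)" for a
      using x(2) SU fV by (intro sum.mono_neutral_left) auto
    have rowy: "(\<Sum>b\<in>V - T. y a b) = (\<Sum>b\<in>V. y a b)" for a
      using y(2) SU fV by (intro sum.mono_neutral_left) auto
    have colx: "(\<Sum>a\<in>S. x a b) = (\<Sum>a\<in>U. x a b)" for b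
      using x(2) SU fU by (intro sum.mono_neutral_left) auto
    have coly: "(\<Sum>a\<in>U - S. y a b) = (\<Sum>a\<in>U. y a b)" for b
      using y(2) SU fU by (intro sum.mono_neutral_left) auto
    have row\<delta>: "(\<Sum>b\<in>V. \<delta> a b) = (if a = u then m else 0)" for a
      using fV uv by (auto simp: \<delta>_def)
    have col\<delta>: "(\<Sum>a\<in>U. \<delta> a b) = (if b = v then m else 0)" for b
      using fU uv by (auto simp: \<delta>_def)
    have "d a \<le> (\<Sum>b\<in>V. z a b)" if a: "a \<in> U" for a
    proof (cases "a \<in> S")
      case True
      have "0 \<le> (\<Sum>b\<in>V. y a b)" "0 \<le> (\<Sum>b\<in>V. \<delta> a b)"
        using y(1) \<delta>0 by (auto intro: sum_nonneg)
      then show ?thesis using x(3)[OF True] rowx[of a] by (simp add: z_def sum.distrib)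
    next
      case False
      have "0 \<le> (\<Sum>b\<in>V. x a b)" using x(1) by (auto intro: sum_nonneg)
      then show ?thesis using y(3)[of a] a False rowy[of a] row\<delta>[of a]
        by (auto simp: z_def sum.distrib d2_def split: if_splits)
    qed
    moreover have "(\<Sum>a\<in>U. z a b) \<le> c b" if b: "b \<in> V" for b
    proof (cases "b \<in> T")
      case True
      have "(\<Sum>a\<in>U. y a b) = 0" using y(2) True by (intro sum.neutral) blast
      then show ?thesis using x(4)[OF True] colx[of b] col\<delta>[of b]
        by (auto simp: z_def sum.distrib c1_def split: if_splits)
    next
      case False
      have "(\<Sum>a\<in>U. x a b) = 0" using x(2) False by (intro sum.neutral) blast
      then show ?thesis using y(4)[of b] b False coly[of b] col\<delta>[of b] SU
        by (auto simp: z_def sum.distrib split: if_splits)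
    qed
    moreover have "a \<in> U \<and> b \<in> V \<and> (a, b) \<in> R" if "z a b \<noteq> 0" for a b
    proof -
      have "x a b \<noteq> 0 \<or> y a b \<noteq> 0 \<or> a = u \<and> b = v"
        using that by (auto simp: z_def \<delta>_def split: if_splits)
      then show ?thesis using x(2)[of a b] y(2)[of a b] uv SU by blast
    qed
    \<comment> \<open>The supports of \<open>x\<close> and \<open>y\<close> share no vertex, since
      \<open>y\<close> lives on the complements of \<open>S\<close> and \<open>T\<close>; only
      \<open>(u, v)\<close> joins them.\<close>
    moreover have "acyclic_pairs {(a, b). z a b \<noteq> 0}"
    proof (rule acyclic_pairs_mono)
      show "acyclic_pairs (insert (u, v) ({(a, b). x a b \<noteq> 0} \<union> {(a, b). y a b \<noteq> 0}))"
        using x(2) y(2) SU uv by (intro acyclic_pairs_bridge x(5) y(5)) fastforce+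
    qed (auto simp: z_def \<delta>_def)
    ultimately have "fractional_matching R U V d c z"
      unfolding fractional_matching_def using z0 by blast
    then show ?thesis by blast
  qed
qed

section \<open>Splitting off a star near the leaves\<close>

text \<open>
  \<open>K\<close> is the set of neighbours that \<open>u\<close> is joined to, and \<open>L\<close> the part of it that becomes unusable
  afterwards: all of \<open>K\<close> if \<open>u\<close> is cut off from the rest, all but one vertex otherwise.
\<close>

lemma fractional_matching_star:
  fixes s :: "'b \<Rightarrow> nat" and h q :: nat
  assumes x: "fractional_matching R A B (\<lambda>_. real q * (real h - 1) + 1) (\<lambda>v. real q - real (s v)) x"
    and fin: "finite A" "finite B" and ne: "A \<noteq> {}" and q: "1 \<le> q" and h: "1 \<le> h"
  obtains u K L s' x' where "u \<in> A" "K \<subseteq> B" "L \<subseteq> K" "card K = h"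
    "\<And>v. v \<in> K \<Longrightarrow> (u, v) \<in> R" "\<And>v. v \<in> K \<Longrightarrow> s v < q"
    "\<And>v w. v \<in> K - L \<Longrightarrow> w \<in> K - L \<Longrightarrow> v = w"
    "\<And>v. v \<in> K - L \<Longrightarrow> 1 + sum s K \<le> s' v" "\<And>v. v \<in> B - K \<Longrightarrow> s' v = s v"
    "fractional_matching R (A - {u}) (B - L) (\<lambda>_. real q * (real h - 1) + 1)
       (\<lambda>v. real q - real (s' v)) x'"
proof -
  have x0: "\<And>a b. 0 \<le> x a b"
    and xR: "\<And>a b. x a b \<noteq> 0 \<Longrightarrow> a \<in> A \<and> b \<in> B \<and> (a, b) \<in> R"
    and row: "\<And>a. a \<in> A \<Longrightarrow> real q * (real h - 1) + 1 \<le> (\<Sum>b\<in>B. x a b)"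
    and col: "\<And>b. b \<in> B \<Longrightarrow> (\<Sum>a\<in>A. x a b) \<le> real q - real (s b)"
    and ac: "acyclic_pairs {(a, b). x a b \<noteq> 0}"
    using x unfolding fractional_matching_def by blast+
  have "{(a, b). x a b \<noteq> 0} \<subseteq> A \<times> B" using xR by blast
  then have "finite {(a, b). x a b \<noteq> 0}" using fin finite_subset by blast
  from acyclic_pairs_near_leaf[OF ac this ne]
  obtain u p where u: "u \<in> A"
    and leaf: "\<And>v w. x u v \<noteq> 0 \<Longrightarrow> v \<noteq> p \<Longrightarrow> w \<in> A \<Longrightarrow> x w v \<noteq> 0 \<Longrightarrow> w = u"
    by auto
  define N where "N = {v \<in> B. x u v \<noteq> 0}"
  have finN: "finite N" using fin by (simp add: N_def)
  have NR: "v \<in> B" "(u, v) \<in> R" "x u v > 0" if "v \<in> N" for v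
    using that xR[of u v] x0[of u v] by (auto simp: N_def)
  have le: "x u v \<le> real q - real (s v)" if "v \<in> B" for v
  proof -
    have "x u v \<le> (\<Sum>a\<in>A. x a v)" using u fin x0 by (intro member_le_sum) auto
    then show ?thesis using col[OF that] by simp
  qed
  have sq: "s v < q" if "v \<in> N" for v
    using le[of v] NR[OF that] by linarith
  have rowN: "real q * (real h - 1) + 1 \<le> (\<Sum>v\<in>N. x u v)"
  proof -
    have "(\<Sum>v\<in>N. x u v) = (\<Sum>v\<in>B. x u v)"
      using fin by (intro sum.mono_neutral_left) (auto simp: N_def)
    then show ?thesis using row[OF u] by simp
  qed
  \<comment> \<open>Each edge carries at most \<open>q\<close>, and the demand exceeds
    \<open>q * (h - 1)\<close>.\<close>
  have cardN: "h \<le> card N"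
  proof -
    have "(\<Sum>v\<in>N. x u v) \<le> (\<Sum>v\<in>N. real q)"
      using le NR by (intro sum_mono) (smt (verit) of_nat_0_le_iff)
    then have "real q * (real h - 1) < real q * real (card N)"
      using rowN by (simp add: mult.commute)
    then have "real h - 1 < real (card N)"
      using q by (simp add: mult_less_cancel_left)
    then show ?thesis using h by linarith
  qed
  define x' where "x' = x(u := \<lambda>_. 0)"
  \<comment> \<open>The vertices of \<open>L\<close> are leaves at \<open>u\<close>, so removing
    them costs no other left vertex any weight. Away from \<open>p\<close> the value of
    \<open>s\<close> is unchanged and the load can only drop, which leaves the bound at
    \<open>p\<close>.\<close>
  have fm: "fractional_matching R (A - {u}) (B - L) (\<lambda>_. real q * (real h - 1) + 1)
       (\<lambda>v. real q - real (s' v)) x'"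
    if L: "L \<subseteq> N" "p \<notin> L"
      and s': "\<And>v. v \<in> B - L \<Longrightarrow> v \<noteq> p \<Longrightarrow> s' v = s v"
      and p: "p \<in> B \<Longrightarrow> (\<Sum>a\<in>A - {u}. x a p) \<le> real q - real (s' p)"
    for L s'
  proof -
    have zero: "x a b = 0" if "a \<in> A - {u}" "b \<in> L" for a b
      using leaf[of b a] that L by (auto simp: N_def)
    have "x' a b \<noteq> 0 \<Longrightarrow> a \<in> A - {u} \<and> b \<in> B - L \<and> (a, b) \<in> R" for a b
      using xR[of a b] zero[of a b] by (auto simp: x'_def split: if_splits)
    moreover have "real q * (real h - 1) + 1 \<le> (\<Sum>b\<in>B - L. x' a b)" if a: "a \<in> A - {u}" for a
    proof -
      have "(\<Sum>b\<in>B - L. x' a b) = (\<Sum>b\<in>B. x a b)"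
        using a fin zero[OF a] by (intro sum.mono_neutral_cong_left) (auto simp: x'_def)
      then show ?thesis using row[of a] a by simp
    qed
    moreover have "(\<Sum>a\<in>A - {u}. x' a b) \<le> real q - real (s' b)" if b: "b \<in> B - L" for b
    proof -
      have eq: "(\<Sum>a\<in>A - {u}. x' a b) = (\<Sum>a\<in>A - {u}. x a b)"
        by (intro sum.cong) (auto simp: x'_def)
      have "(\<Sum>a\<in>A - {u}. x a b) \<le> (\<Sum>a\<in>A. x a b)"
        using fin x0 by (intro sum_mono2) auto
      then show ?thesis using eq col[of b] s'[of b] p b by (cases "b = p") auto
    qed
    moreover have "acyclic_pairs {(a, b). x' a b \<noteq> 0}"
      by (rule acyclic_pairs_mono[OF ac]) (auto simp: x'_def split: if_splits)
    moreover have "0 \<le> x' a b" for a b using x0 by (simp add: x'_def)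
    ultimately show ?thesis unfolding fractional_matching_def by blast
  qed
  have colp: "(\<Sum>a\<in>A - {u}. x a p) = (\<Sum>a\<in>A. x a p) - x u p"
    using fin u by (simp add: sum_diff1)
  show thesis
  proof (cases "h \<le> card (N - {p})")
    case True
    then obtain K where K: "K \<subseteq> N - {p}" "card K = h" 
      using obtain_subset_with_card_n by metis
    \<comment> \<open>All vertices of this star are leaves other than \<open>p\<close>, so it is
      separate from the rest: \<open>L\<close> is all of \<open>K\<close>, and \<open>s\<close>
      stays as it is.\<close>
    show thesis
    proof (rule that[of u K K s x'])
      show "fractional_matching R (A - {u}) (B - K) (\<lambda>_. real q * (real h - 1) + 1)
          (\<lambda>v. real q - real (s v)) x'"
        using K col[of p] colp x0[of u p] by (intro fm) auto
    qed (use u K NR sq in auto)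
  next
    case False
    then have pN: "p \<in> N" and cN: "card N = h"
      using cardN finN by (auto simp: card_Diff_singleton_if split: if_splits)
    \<comment> \<open>Now \<open>u\<close> and everything hanging at its neighbours,
      \<open>p\<close> included, hangs at \<open>p\<close>.\<close>
    define s' where "s' = s(p := 1 + sum s N)"
    \<comment> \<open>The leaves absorb at most \<open>q * (h - 1)\<close> less their values of
      \<open>s\<close>, so the demand of \<open>u\<close> sends to \<open>p\<close> at least the
      amount by which \<open>s\<close> grows there. Dropping \<open>u\<close> frees that
      capacity.\<close>
    have "(\<Sum>v\<in>N - {p}. x u v) \<le> (\<Sum>v\<in>N - {p}. real q - real (s v))"
      using le NR by (intro sum_mono) auto
    also have "\<dots> = real q * (real h - 1) - real (sum s (N - {p}))"
      using pN cN finN h by (simp add: sum_subtractf of_nat_diff mult.commute)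
    finally have "1 + real (sum s (N - {p})) \<le> x u p"
      using rowN sum.remove[OF finN pN, of "x u"] by linarith
    moreover have "sum s N = s p + sum s (N - {p})" by (rule sum.remove[OF finN pN])
    ultimately have main: "(\<Sum>a\<in>A - {u}. x a p) \<le> real q - real (s' p)"
      using col[of p] NR[OF pN] colp by (simp add: s'_def)
    show thesis
    proof (rule that[of u N "N - {p}" s' x'])
      show "fractional_matching R (A - {u}) (B - (N - {p})) (\<lambda>_. real q * (real h - 1) + 1)
          (\<lambda>v. real q - real (s' v)) x'"
        using main by (intro fm) (auto simp: s'_def)
    qed (use u cN pN NR sq in \<open>auto simp: s'_def\<close>)
  qed
qed

section \<open>Cycles after adding a star\<close>

text \<open>This allows a cycle to start at any of its vertices, in particular at the centre of the
  star.\<close>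

lemma cycle_rotate:
  assumes "cycle W F (ys @ zs)"
  shows "cycle W F (zs @ ys)"
proof (cases "ys = [] \<or> zs = []")
  case True
  then show ?thesis using assms by (elim disjE) simp_all
next
  case False
  then have ne: "ys \<noteq> []" "zs \<noteq> []" by simp_all
  have "successively (\<lambda>x y. {x, y} \<in> F) ys" "successively (\<lambda>x y. {x, y} \<in> F) zs"
    "{last ys, hd zs} \<in> F" "{last zs, hd ys} \<in> F"
    and rest: "set (ys @ zs) \<subseteq> W" "distinct (ys @ zs)" "3 \<le> length (ys @ zs)"
    using assms ne unfolding cycle_def walk_def successively_append_iff by simp_all
  then have "successively (\<lambda>x y. {x, y} \<in> F) (zs @ ys)" "{last (zs @ ys), hd (zs @ ys)} \<in> F"
    using ne unfolding successively_append_iff by simp_all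
  moreover have "set (zs @ ys) \<subseteq> W" "distinct (zs @ ys)" "3 \<le> length (zs @ ys)"
    using rest by auto
  ultimately show ?thesis using ne unfolding cycle_def walk_def by blast
qed

lemma walk_label_eq:
  assumes "\<And>a b. {a, b} \<in> F \<Longrightarrow> f a = f b" and "walk W F p"
  shows "f (hd p) = f (last p)"
proof -
  have "p \<noteq> [] \<Longrightarrow> successively (\<lambda>x y. {x, y} \<in> F) p \<Longrightarrow> f (hd p) = f (last p)"
    using assms(1) by (induction p) (auto simp: successively_Cons split: if_splits)
  then show ?thesis using assms(2) by (simp add: walk_def)
qed

text \<open>A cycle through \<open>u\<close> leaves and returns by two different vertices of
  \<open>K\<close>. Between them it runs in \<open>F\<close>, along which labels are constant,
  against injectivity on \<open>K\<close>.\<close>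

lemma no_cycle_star:
  assumes ac: "\<nexists>p. cycle UNIV F p"
    and f: "\<And>a b. {a, b} \<in> F \<Longrightarrow> f a = f b"
    and u: "u \<notin> \<Union>F" and inj: "inj_on f K"
  shows "\<nexists>p. cycle UNIV (F \<union> (\<lambda>v. {u, v}) ` K) p"
proof
  let ?F = "F \<union> (\<lambda>v. {u, v}) ` K"
  assume "\<exists>p. cycle UNIV ?F p"
  then obtain p where p: "cycle UNIV ?F p" by blast
  have old: "{a, b} \<in> F" if "{a, b} \<in> ?F" "a \<noteq> u" "b \<noteq> u" for a b
    using that by (auto simp: doubleton_eq_iff)
  have new: "b \<in> K" if "{u, b} \<in> ?F" for b
    using that u by (auto simp: doubleton_eq_iff)
  have walk: "walk UNIV F q" if "walk UNIV ?F q" "u \<notin> set q" for q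
    using that old unfolding walk_def by (metis (no_types, lifting) successively_mono)
  show False
  proof (cases "u \<in> set p")
    case False
    moreover have "hd p \<in> set p" "last p \<in> set p"
      using p by (auto simp: cycle_def walk_def)
    ultimately have "cycle UNIV F p"
      using p walk[of p] old[of "last p" "hd p"] unfolding cycle_def by metis
    then show False using ac by blast
  next
    case True
    then obtain ys zs where "p = ys @ u # zs" by (meson split_list)
    then have "cycle UNIV ?F ((u # zs) @ ys)" using p cycle_rotate by blast
    then have q: "cycle UNIV ?F (u # (zs @ ys))" by simp
    define q where "q = zs @ ys"
    have len: "2 \<le> length q" and dist: "distinct q" "u \<notin> set q"
      and wq: "successively (\<lambda>x y. {x, y} \<in> ?F) (u # q)" and l: "{last (u # q), u} \<in> ?F"
      using q unfolding cycle_def walk_def q_def[symmetric] by simp_all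
    have ne: "q \<noteq> []" using len by auto
    have uq: "{u, hd q} \<in> ?F" "successively (\<lambda>x y. {x, y} \<in> ?F) q"
      using wq ne unfolding successively_Cons by blast+
    have "{u, last q} \<in> ?F" using l ne by (metis insert_commute last_ConsR)
    then have "last q \<in> K" by (rule new)
    moreover have "hd q \<in> K" using uq(1) by (rule new)
    moreover have "f (hd q) = f (last q)"
    proof (rule walk_label_eq[OF f])
      show "walk UNIV F q"
        using uq(2) ne dist(2) walk[of q] unfolding walk_def by blast
    qed
    ultimately have "hd q = last q" using inj by (auto dest: inj_onD)
    then show False using len dist ne by (cases q) (auto split: if_splits)
  qed
qed

section \<open>Building the matching star by star\<close>

text \<open>
  \<open>A\<close> is the set of left vertices still to be processed. The labelling \<open>f\<close> is constant on the components
  of \<open>F\<close>, so a label class bounds the size of a component from above.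
\<close>

definition partial_matching ::
  "nat \<Rightarrow> 'a set \<Rightarrow> 'a set set \<Rightarrow> 'a set \<Rightarrow> 'a set set \<Rightarrow> ('a \<Rightarrow> 'a) \<Rightarrow> bool" where
  "partial_matching h U E A F f \<longleftrightarrow>
     F \<subseteq> E \<and> (\<nexists>p. cycle UNIV F p) \<and> (\<forall>a b. {a, b} \<in> F \<longrightarrow> f a = f b) \<and>
     A \<inter> \<Union>F = {} \<and> (\<forall>u\<in>U - A. degree F u = h) \<and> (\<forall>u\<in>A. \<forall>w. f w = f u \<longrightarrow> w = u)"

text \<open>The label \<open>f u\<close> belongs to \<open>u\<close> alone before the step, so
  giving it to all classes that meet \<open>K\<close> merges these with \<open>u\<close> and
  disturbs no other class.\<close>

lemma partial_matching_star:
  assumes pm: "partial_matching h U E A F f" and u: "u \<in> A" "A \<subseteq> U"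
    and K: "K \<inter> U = {}" "card K = h" "\<And>v. v \<in> K \<Longrightarrow> {u, v} \<in> E" "inj_on f K"
  shows "partial_matching h U E (A - {u}) (F \<union> (\<lambda>v. {u, v}) ` K)
    (\<lambda>w. if f w \<in> f ` K then f u else f w)" (is "partial_matching h U E _ ?F ?f")
proof -
  have F: "F \<subseteq> E" "\<nexists>p. cycle UNIV F p" "\<And>a b. {a, b} \<in> F \<Longrightarrow> f a = f b"
    "A \<inter> \<Union>F = {}" "\<And>w. w \<in> U - A \<Longrightarrow> degree F w = h"
    "\<And>a w. a \<in> A \<Longrightarrow> f w = f a \<Longrightarrow> w = a"
    using pm unfolding partial_matching_def by blast+
  have g1: "?F \<subseteq> E" using F(1) K(3) by blast
  have g2: "\<nexists>p. cycle UNIV ?F p"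
    using F(2-4) K(4) u by (intro no_cycle_star[of F f]) auto
  have g3: "?f a = ?f b" if "{a, b} \<in> ?F" for a b
  proof (cases "{a, b} \<in> F")
    case True
    then have "f a = f b" by (rule F(3))
    then show ?thesis by simp
  next
    case False
    then show ?thesis using that by (auto simp: doubleton_eq_iff)
  qed
  have g4: "(A - {u}) \<inter> \<Union>?F = {}"
    using F(4) K(1) u by auto
  have g5: "degree ?F w = h" if w: "w \<in> U - (A - {u})" for w
  proof (cases "w = u")
    case True
    have "{e \<in> ?F. u \<in> e} = (\<lambda>v. {u, v}) ` K" using F(4) u by blast
    moreover have "inj_on (\<lambda>v. {u, v}) K" by (auto simp: inj_on_def doubleton_eq_iff)
    ultimately show ?thesis using K(2) True by (simp add: degree_def card_image)
  next
    case False
    then have "{e \<in> ?F. w \<in> e} = {e \<in> F. w \<in> e}" using K(1) w by auto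
    then show ?thesis using F(5)[of w] w False by (simp add: degree_def)
  qed
  have g6: "w = a" if "a \<in> A - {u}" "?f w = ?f a" for a w
  proof -
    \<comment> \<open>A vertex of \<open>K\<close> with the label of \<open>a\<close> would be
      \<open>a\<close> itself, but \<open>K\<close> avoids \<open>U\<close>.\<close>
    have "f a \<notin> f ` K" using F(6)[of a] that(1) K(1) u by auto
    moreover have "f a \<noteq> f u" using F(6)[of a u] that(1) by auto
    ultimately show ?thesis using that F(6)[of a w] by (auto split: if_splits)
  qed
  show ?thesis unfolding partial_matching_def
    by (intro conjI allI ballI impI g1 g2 g4) (rule g3 g5 g6; assumption)+
qed

text \<open>Induction on the number of unprocessed left vertices, one star per step. Injectivity of
  \<open>f\<close> on \<open>B\<close> keeps the usable right vertices in different components, so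
  no star closes a cycle; \<open>s v\<close> bounds the processed left vertices in the class of
  \<open>v\<close>.\<close>

lemma complete_partial_matching:
  fixes s :: "'a \<Rightarrow> nat" and h q :: nat
  assumes fin: "finite U" "finite V" and disj: "U \<inter> V = {}" and q: "1 \<le> q" and h: "1 \<le> h"
    and "partial_matching h U E A F f" "A \<subseteq> U" "B \<subseteq> V" "inj_on f B"
    and "fractional_matching {(u, v). {u, v} \<in> E} A B
       (\<lambda>_. real q * (real h - 1) + 1) (\<lambda>v. real q - real (s v)) x"
    and "\<And>v. v \<in> B \<Longrightarrow> card {w \<in> U - A. f w = f v} \<le> s v"
    and "\<And>l. card {w \<in> U - A. f w = l} \<le> h * (q - 1) + 1"
  shows "\<exists>F f. partial_matching h U E {} F f \<and> (\<forall>l. card {w \<in> U. f w = l} \<le> h * (q - 1) + 1)"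
  using assms(6-)
proof (induction "card A" arbitrary: A B F f s x)
  case 0
  have "A = {}" using 0 fin finite_subset by fastforce
  then show ?case using 0 by auto
next
  case (Suc n)
  note pm = Suc.prems(1) and AU = Suc.prems(2) and BV = Suc.prems(3) and inj = Suc.prems(4)
    and x = Suc.prems(5) and sB = Suc.prems(6) and sz = Suc.prems(7)
  have finAB: "finite A" "finite B" using AU BV fin finite_subset by auto
  have "A \<noteq> {}" using Suc.hyps(2) by auto
  obtain u K L s' x' where u: "u \<in> A" and KB: "K \<subseteq> B" and LK: "L \<subseteq> K" and cK: "card K = h"
    and KR: "\<And>v. v \<in> K \<Longrightarrow> (u, v) \<in> {(u, v). {u, v} \<in> E}" and Kq: "\<And>v. v \<in> K \<Longrightarrow> s v < q"
    and K1: "\<And>v w. v \<in> K - L \<Longrightarrow> w \<in> K - L \<Longrightarrow> v = w"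
    and s'K: "\<And>v. v \<in> K - L \<Longrightarrow> 1 + sum s K \<le> s' v"
    and s's: "\<And>v. v \<in> B - K \<Longrightarrow> s' v = s v"
    and x': "fractional_matching {(u, v). {u, v} \<in> E} (A - {u}) (B - L)
       (\<lambda>_. real q * (real h - 1) + 1) (\<lambda>v. real q - real (s' v)) x'"
    by (rule fractional_matching_star[OF x finAB \<open>A \<noteq> {}\<close> q h], rule that)
  have KE: "{u, v} \<in> E" if "v \<in> K" for v using KR[OF that] by simp
  define F' where "F' = F \<union> (\<lambda>v. {u, v}) ` K"
  define f' where "f' = (\<lambda>w. if f w \<in> f ` K then f u else f w)"
  have uniq: "w = a" if "a \<in> A" "f w = f a" for a w
    using pm that unfolding partial_matching_def by blast
  have finK: "finite K" using KB finAB finite_subset by blast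
  have pm': "partial_matching h U E (A - {u}) F' f'"
    unfolding F'_def f'_def using KB BV disj inj
    by (intro partial_matching_star[OF pm u AU _ cK KE]) (auto intro: inj_on_subset)
  have fuB: "f u \<noteq> f v" if "v \<in> B" for v
  proof
    assume "f u = f v"
    then have "v = u" using uniq[OF u] by simp
    then show False using that BV AU u disj by blast
  qed
  have val: "f' y = (if y \<in> K then f u else f y)" if "y \<in> B" for y
    using inj_on_image_mem_iff[OF inj that KB] by (simp add: f'_def)
  \<comment> \<open>At most one vertex of \<open>K\<close> survives in \<open>B - L\<close>, and no
    vertex of \<open>B\<close> outside \<open>K\<close> carries the label
    \<open>f u\<close>.\<close>
  have inj': "inj_on f' (B - L)"
  proof (rule inj_onI)
    fix v w assume vw: "v \<in> B - L" "w \<in> B - L" "f' v = f' w"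
    have B: "v \<in> B" "w \<in> B" using vw by auto
    consider "v \<in> K" "w \<in> K" | "v \<in> K" "w \<notin> K" | "v \<notin> K" "w \<in> K" | "v \<notin> K" "w \<notin> K"
      by blast
    then show "v = w"
    proof cases
      case 1
      then show ?thesis using vw K1[of v w] by blast
    next
      case 2
      then show ?thesis using vw(3) fuB[OF B(2)] val B by simp
    next
      case 3
      then show ?thesis using vw(3) fuB[OF B(1)] val B by simp
    next
      case 4
      then show ?thesis using vw(3) val B inj_onD[OF inj, of v w] by simp
    qed
  qed
  \<comment> \<open>Labels are of three kinds: untouched ones, those of \<open>K\<close>, whose
    classes are emptied, and \<open>f u\<close>, whose class takes these in.\<close>
  have old: "{w \<in> U - (A - {u}). f' w = l} = {w \<in> U - A. f w = l}" if "l \<noteq> f u" "l \<notin> f ` K" for l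
    using that by (auto simp: f'_def)
  have gone: "{w \<in> U - (A - {u}). f' w = l} = {}" if "l \<noteq> f u" "l \<in> f ` K" for l
    using that by (auto simp: f'_def)
  have merged: "card {w \<in> U - (A - {u}). f' w = f u} \<le> 1 + sum s K"
  proof -
    have "{w \<in> U - (A - {u}). f' w = f u} \<subseteq> insert u (\<Union>v\<in>K. {w \<in> U - A. f w = f v})"
      using uniq[OF u] by (auto simp: f'_def split: if_splits)
    then have "card {w \<in> U - (A - {u}). f' w = f u}
        \<le> card (insert u (\<Union>v\<in>K. {w \<in> U - A. f w = f v}))"
      using fin finK by (intro card_mono) auto
    also have "\<dots> \<le> Suc (card (\<Union>v\<in>K. {w \<in> U - A. f w = f v}))"
      by (rule card_insert_le_m1) auto
    also have "card (\<Union>v\<in>K. {w \<in> U - A. f w = f v}) \<le> (\<Sum>v\<in>K. card {w \<in> U - A. f w = f v})"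
      by (rule card_UN_le[OF finK])
    also have "\<dots> \<le> sum s K" using sB KB by (intro sum_mono) auto
    finally show ?thesis by simp
  qed
  \<comment> \<open>Each of the \<open>h\<close> vertices of \<open>K\<close> contributes at most
    \<open>q - 1\<close>; together with \<open>u\<close> this gives the size bound
    \<open>h * (q - 1) + 1\<close>.\<close>
  have sK: "sum s K \<le> h * (q - 1)"
    using Kq sum_bounded_above[of K s "q - 1"] cK by fastforce
  have "n = card (A - {u})" using Suc.hyps(2) u finAB by simp
  moreover have "card {w \<in> U - (A - {u}). f' w = f' v} \<le> s' v" if v: "v \<in> B - L" for v
  proof (cases "v \<in> K")
    case True
    then show ?thesis using merged s'K[of v] v val[of v] by simp
  next
    case False
    then have "f v \<notin> f ` K" using v inj_on_image_mem_iff[OF inj _ KB] by blast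
    moreover have "f v \<noteq> f u" using fuB[of v] v by simp
    ultimately show ?thesis using old[of "f v"] sB[of v] s's[of v] v False val[of v] by simp
  qed
  moreover have "card {w \<in> U - (A - {u}). f' w = l} \<le> h * (q - 1) + 1" for l
  proof -
    consider "l = f u" | "l \<noteq> f u" "l \<in> f ` K" | "l \<noteq> f u" "l \<notin> f ` K" by blast
    then show ?thesis
    proof cases
      case 1
      then show ?thesis using le_trans[OF merged, of "h * (q - 1) + 1"] sK by simp
    next
      case 2
      then show ?thesis unfolding gone[OF 2] by simp
    next
      case 3
      then show ?thesis unfolding old[OF 3] by (intro sz)
    qed
  qed
  ultimately show ?case
    using AU BV by (intro Suc.hyps(1)[OF _ pm' _ _ inj' x']) blast+
qed

section \<open>From label classes to component sizes\<close>

text \<open>Every edge inside \<open>C\<close> has its left end in \<open>U \<inter> C\<close> and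
  is counted by the degree there.\<close>

lemma card_induced_edges_le:
  assumes "bipartite_graph U V E" "F \<subseteq> E" "\<And>u. u \<in> U \<Longrightarrow> degree F u \<le> h" "card (U \<inter> C) \<le> k"
  shows "card (induced_edges F C) \<le> h * k"
proof -
  have fin: "finite (U \<union> V)" "finite U" and E: "\<And>e. e \<in> E \<Longrightarrow> \<exists>u\<in>U. u \<in> e"
    and "E \<subseteq> Pow (U \<union> V)"
    using assms(1) unfolding bipartite_graph_def simple_graph_def by auto
  then have "finite E" using finite_subset by blast
  then have finF: "finite F" using assms(2) finite_subset by blast
  have "induced_edges F C \<subseteq> (\<Union>u\<in>U \<inter> C. {e \<in> F. u \<in> e})"
  proof
    fix e assume "e \<in> induced_edges F C"
    then have e: "e \<in> F" "e \<subseteq> C" by (auto simp: induced_edges_def)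
    then obtain u where "u \<in> U" "u \<in> e" using E assms(2) by blast
    then show "e \<in> (\<Union>u\<in>U \<inter> C. {e \<in> F. u \<in> e})" using e by blast
  qed
  then have "card (induced_edges F C) \<le> card (\<Union>u\<in>U \<inter> C. {e \<in> F. u \<in> e})"
    using fin finF by (intro card_mono) auto
  also have "\<dots> \<le> (\<Sum>u\<in>U \<inter> C. degree F u)"
    unfolding degree_def using fin by (intro card_UN_le) auto
  also have "\<dots> \<le> (\<Sum>u\<in>U \<inter> C. h)" using assms(3) by (intro sum_mono) auto
  also have "\<dots> \<le> h * k" using assms(4) by simp
  finally show ?thesis .
qed

text \<open>A connected component carries a single label, so the class size bounds its left vertices
  and \<open>h\<close> times that bounds its edges.\<close>

lemma st_matching_of_partial_matching:
  assumes G: "bipartite_graph U V E" and pm: "partial_matching h U E {} F f"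
    and sz: "\<And>l. card {w \<in> U. f w = l} \<le> k"
  shows "st_matching h (h * k) U V E F"
proof -
  have F: "F \<subseteq> E" "\<nexists>p. cycle UNIV F p" "\<And>a b. {a, b} \<in> F \<Longrightarrow> f a = f b"
    "\<And>u. u \<in> U \<Longrightarrow> degree F u = h"
    using pm unfolding partial_matching_def by blast+
  have "tree C (induced_edges F C) \<and> card (induced_edges F C) \<le> h * k"
    if C: "component (U \<union> V) F C" for C
  proof -
    have con: "connected_graph C (induced_edges F C)" using C by (simp add: component_def)
    have ind: "induced_edges F C \<subseteq> F" by (auto simp: induced_edges_def)
    have "\<not> cycle C (induced_edges F C) p" for p
    proof
      assume c: "cycle C (induced_edges F C) p"
      then have "successively (\<lambda>x y. {x, y} \<in> F) p"
        using ind unfolding cycle_def walk_def by (meson subsetD successively_mono)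
      then have "cycle UNIV F p" using c ind unfolding cycle_def walk_def by auto
      then show False using F(2) by blast
    qed
    then have "tree C (induced_edges F C)" using con by (simp add: tree_def)
    moreover have "card (U \<inter> C) \<le> k"
    proof -
      have lab: "f a = f b" if "a \<in> C" "b \<in> C" for a b
      proof -
        have "\<exists>p. walk C (induced_edges F C) p \<and> hd p = a \<and> last p = b"
          using con that by (simp add: connected_graph_def)
        then obtain p where p: "walk C (induced_edges F C) p" "hd p = a" "last p = b"
          by (elim exE conjE)
        have "f c = f d" if "{c, d} \<in> induced_edges F C" for c d
          by (rule F(3)[OF subsetD[OF ind that]])
        from walk_label_eq[OF this p(1)] show ?thesis using p(2,3) by simp
      qed
      obtain c where "c \<in> C" using con unfolding connected_graph_def by blast
      then have "U \<inter> C \<subseteq> {w \<in> U. f w = f c}" using lab by blast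
      moreover have "finite U" using G by (simp add: bipartite_graph_def simple_graph_def)
      ultimately have "card (U \<inter> C) \<le> card {w \<in> U. f w = f c}" by (intro card_mono) auto
      then show ?thesis using sz[of "f c"] by simp
    qed
    ultimately show ?thesis using card_induced_edges_le[OF G F(1)] F(4) by simp
  qed
  then show ?thesis using F unfolding st_matching_def by blast
qed

theorem theorem1p3:
  fixes k h :: nat and U V :: "'a set" and E :: "'a set set"
  assumes "1 \<le> k" and "2 \<le> h"
    and "bipartite_graph U V E"
    and "\<And>S. S \<subseteq> U \<Longrightarrow>
      real (card (neighbours E S))
        \<ge> (real h - 1 + 1 / real_of_int \<lceil>real k / real h\<rceil>) * real (card S)"
  shows "\<exists>F. st_matching h (h * k) U V E F"
proof -
  define q where "q = nat \<lceil>real k / real h\<rceil>"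
  have "0 < real k / real h" using assms(1,2) by simp
  then have pos: "0 < \<lceil>real k / real h\<rceil>" by linarith
  then have rq: "real q = real_of_int \<lceil>real k / real h\<rceil>" by (simp add: q_def)
  have q: "1 \<le> q" using pos unfolding q_def by linarith
  \<comment> \<open>Rounding up adds less than one, so \<open>h * (q - 1)\<close> stays strictly
    below \<open>k\<close>, which leaves room for one more left vertex.\<close>
  have "real q - 1 < real k / real h" unfolding rq by linarith
  then have "real h * (real q - 1) < real k"
    using assms(2) by (simp add: field_simps)
  then have "real (h * (q - 1)) < real k" using q by (simp add: of_nat_diff)
  then have hq: "h * (q - 1) + 1 \<le> k" unfolding of_nat_less_iff by simp
  have fin: "finite U" "finite V" and disj: "U \<inter> V = {}"
    using assms(3) by (auto simp: bipartite_graph_def simple_graph_def)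
  let ?R = "{(u, v). {u, v} \<in> E}"
  \<comment> \<open>Multiplying the hypothesis by \<open>q\<close> clears the fraction: the demand
    becomes \<open>q * (h - 1) + 1\<close> at each left vertex and the capacity \<open>q\<close> at
    each right vertex.\<close>
  have hall: "(\<Sum>u\<in>S. real q * (real h - 1) + 1) \<le> (\<Sum>v\<in>?R `` S \<inter> V. real q)" if S: "S \<subseteq> U" for S
  proof -
    have "w \<in> V" if xw: "x \<in> U" "{x, w} \<in> E" for x w
    proof -
      obtain u v where "u \<in> U" "v \<in> V" "{x, w} = {u, v}"
        using assms(3) xw(2) unfolding bipartite_graph_def by blast
      then show ?thesis using disj xw(1) by (auto simp: doubleton_eq_iff)
    qed
    then have "neighbours E S = ?R `` S \<inter> V" using S by (auto simp: neighbours_def)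
    then have "(real h - 1 + 1 / real q) * real (card S) \<le> real (card (?R `` S \<inter> V))"
      using assms(4)[OF S] rq by simp
    then have "real q * ((real h - 1 + 1 / real q) * real (card S))
        \<le> real q * real (card (?R `` S \<inter> V))"
      by (rule mult_left_mono) simp
    moreover have "real q * (real h - 1 + 1 / real q) = real q * (real h - 1) + 1"
      using q by (simp add: distrib_left)
    ultimately have "(real q * (real h - 1) + 1) * real (card S) \<le> real q * real (card (?R `` S \<inter> V))"
      by (simp only: mult.assoc[symmetric])
    then show ?thesis by (simp add: mult.commute)
  qed
  have "\<exists>x. fractional_matching ?R U V (\<lambda>_. real q * (real h - 1) + 1) (\<lambda>_. real q) x"
    using fin hall by (intro fractional_hall) auto
  \<comment> \<open>Nothing hangs at any vertex yet, so the capacity \<open>q\<close> is written as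
    \<open>q - s v\<close> with \<open>s v = 0\<close>.\<close>
  then obtain x where
    x: "fractional_matching ?R U V (\<lambda>_. real q * (real h - 1) + 1) (\<lambda>_. real q - real 0) x"
    by auto
  \<comment> \<open>At the start all of \<open>U\<close> is unprocessed and each vertex is its own
    class.\<close>
  have pm: "partial_matching h U E U {} id"
    by (auto simp: partial_matching_def cycle_def)
  have "\<exists>F f. partial_matching h U E {} F f \<and> (\<forall>l. card {w \<in> U. f w = l} \<le> h * (q - 1) + 1)"
    using assms(2)
    by (intro complete_partial_matching[OF fin disj q _ pm subset_refl subset_refl _ x]) simp_all
  then obtain F f where "partial_matching h U E {} F f"
    "\<And>l. card {w \<in> U. f w = l} \<le> h * (q - 1) + 1"
    by blast
  then have "st_matching h (h * k) U V E F"
    using hq by (intro st_matching_of_partial_matching[OF assms(3)]) (auto intro: order_trans)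
  then show ?thesis by blast
qed

end
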